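(* Consider the system of differential equations \[ \frac{d\varphi}{d\tau}=\psi,\qquad \frac{d\psi}{d\tau}=(s(\Omega))^2\sin\varphi\cos\varphi-\frac{g}{l}\sin\varphi-\frac1m\,h(\psi),\qquad \frac{d\Omega}{d\tau}=\frac1I\left(M(\varphi)-F\right), \] and let $P_0=(\varphi_0,0,\Omega_0)$ be an equilibrium point. If \[ h'(0)>-\frac{2m}{I}\,\frac{s'(\Omega_0)}{s(\Omega_0)}\,M'(\varphi_0)\cot\varphi_0 , \] then $P_0$ is an asymptotically stable equilibrium point of the system. If \[ 0<h'(0)<-\frac{2m}{I}\,\frac{s'(\Omega_0)}{s(\Omega_0)}\,M'(\varphi_0)\cot\varphi_0 , \] then $P_0$ is unstable.
   Context: The state is $(\varphi,\psi,\Omega)$ with $\varphi\in(0,\pi/2)$, $\psi\in\mathbb R$, $\Omega\in[0,\infty)$. The constants $g,l,m,I$ are positive. The function $s$ is smooth, non-negative and increasing with $s(0)=0$; $h$ is smooth and increasing with $h(0)=0$; $M$ is smooth and decreasing; $F$ is a constant, $F=M(\varphi_0)$ where $\varphi_0$ is the equilibrium angle. Monotonicity is understood in the sense that $s'(\Omega_0)>0$ and $M'(\varphi_0)<0$. Being an equilibrium with $\varphi_0\in(0,\pi/2)$ means $(s(\Omega_0))^2\cos\varphi_0=g/l$ and $M(\varphi_0)=F$; in particular $s(\Omega_0)>0$ and $\Omega_0>0$. Stability and instability are in the sense of Lyapunov. *)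

theory Defs
  imports "HOL-Analysis.Analysis"
begin

text \<open>
  Infinitely often differentiable on \<open>S\<close>, witnessed by the sequence of successive derivatives.
  At an endpoint belonging to the interval \<open>S\<close> the derivatives are one-sided.
\<close>

definition smooth_on :: "real set \<Rightarrow> (real \<Rightarrow> real) \<Rightarrow> bool" where
  "smooth_on S f \<longleftrightarrow>
     (\<exists>D :: nat \<Rightarrow> real \<Rightarrow> real. D 0 = f \<and>
        (\<forall>k. \<forall>x\<in>S. (D k has_real_derivative D (Suc k) x) (at x within S)))"

definition solution_on ::
  "('a::real_normed_vector \<Rightarrow> 'a) \<Rightarrow> 'a set \<Rightarrow> real set \<Rightarrow> (real \<Rightarrow> 'a) \<Rightarrow> bool" where
  "solution_on f X J x \<longleftrightarrow>
     (\<forall>t\<in>J. x t \<in> X \<and> (x has_vector_derivative f (x t)) (at t within J))"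

definition equilibrium_point ::
  "('a::real_normed_vector \<Rightarrow> 'a) \<Rightarrow> 'a set \<Rightarrow> 'a \<Rightarrow> bool" where
  "equilibrium_point f X P \<longleftrightarrow> P \<in> X \<and> f P = 0"

text \<open>
  A solution starting near \<open>P\<close> exists for all future times, and every solution starting there,
  on whatever interval \<open>[0,T)\<close> it is defined, stays near \<open>P\<close>. Quantifying over all \<open>T\<close> also
  covers solutions that would leave \<open>X\<close> or blow up in finite time.
\<close>

definition lyapunov_stable ::
  "('a::real_normed_vector \<Rightarrow> 'a) \<Rightarrow> 'a set \<Rightarrow> 'a \<Rightarrow> bool" where
  "lyapunov_stable f X P \<longleftrightarrow> equilibrium_point f X P \<and>
     (\<forall>\<epsilon>>0. \<exists>\<delta>>0. \<forall>x0\<in>X. dist x0 P < \<delta> \<longrightarrow>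
        (\<exists>x. solution_on f X {0..} x \<and> x 0 = x0) \<and>
        (\<forall>T>0. \<forall>x. solution_on f X {0..<T} x \<and> x 0 = x0 \<longrightarrow>
           (\<forall>t\<in>{0..<T}. dist (x t) P < \<epsilon>)))"

definition asymptotically_stable ::
  "('a::real_normed_vector \<Rightarrow> 'a) \<Rightarrow> 'a set \<Rightarrow> 'a \<Rightarrow> bool" where
  "asymptotically_stable f X P \<longleftrightarrow> lyapunov_stable f X P \<and>
     (\<exists>\<eta>>0. \<forall>x. solution_on f X {0..} x \<and> dist (x 0) P < \<eta> \<longrightarrow> (x \<longlongrightarrow> P) at_top)"

definition unstable ::
  "('a::real_normed_vector \<Rightarrow> 'a) \<Rightarrow> 'a set \<Rightarrow> 'a \<Rightarrow> bool" where
  "unstable f X P \<longleftrightarrow> equilibrium_point f X P \<and> \<not> lyapunov_stable f X P"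

definition state_space :: "(real \<times> real \<times> real) set" where
  "state_space = {0<..<pi/2} \<times> UNIV \<times> {0..}"

definition governor_field ::
  "real \<Rightarrow> real \<Rightarrow> real \<Rightarrow> real \<Rightarrow> real \<Rightarrow> (real \<Rightarrow> real) \<Rightarrow> (real \<Rightarrow> real) \<Rightarrow> (real \<Rightarrow> real) \<Rightarrow>
   real \<times> real \<times> real \<Rightarrow> real \<times> real \<times> real" where
  "governor_field g l m I F s h M = (\<lambda>(\<phi>, \<psi>, \<Omega>).
     (\<psi>,
      (s \<Omega>)\<^sup>2 * sin \<phi> * cos \<phi> - g / l * sin \<phi> - 1 / m * h \<psi>,
      1 / I * (M \<phi> - F)))"

end

theory Submission imports Defs begin

text \<open>
  Write $a = s(\Omega_0)^2 \sin^2\varphi_0$, $b = h'(0)/m$,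
  $c = 2 s(\Omega_0) s'(\Omega_0) \sin\varphi_0 \cos\varphi_0$ and $d = -M'(\varphi_0)/I$. The balance
  $s(\Omega_0)^2\cos\varphi_0 = g/l$ turns the linearization at the equilibrium into
  $x' = y$, $y' = -a x - b y + c z$, $z' = -d x$, whose characteristic polynomial is
  $\lambda^3 + b\lambda^2 + a\lambda + cd$. The hypotheses on $h'(0)$ say exactly that
  $ab > cd$ (the Routh-Hurwitz condition) or $ab < cd$.

  In place of eigenvalues, explicit quadratic forms decide. With $e = cd$, $p = cz$, $q = p'$,
  $r = p''$ the linear system is $p''' + b p'' + a p' + e p = 0$. The form
  $E = (r + bq)^2 + 2epq + aq^2 + bep^2$ changes at the rate $-2(ab - e) q^2$, and it is positive
  definite if $ab > e$. Its rate vanishes on the plane $q = 0$; there the rate of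
  $N = 2epr - 2b^2qr$ is strictly negative. A weight $K$ large enough (Finsler's lemma) makes
  $KE + N$ positive definite with negative definite rate when $ab > e$, and makes the rate of
  $KE - N$ positive definite when $ab < e$, while $KE - N$ still takes positive values
  (\<open>companion_decreasing_form\<close>, \<open>companion_increasing_form\<close>).

  Definite rates survive the nonlinear remainder close to the equilibrium, so the first form is a
  strict Lyapunov function
  (\<open>symmetric_form.asymptotically_stable_if_linearization_decreases\<close>), and the second grows
  exponentially along any solution that starts where it is positive and stays close to the
  equilibrium, which is impossible for a bounded solution: Chetaev's argument
  (\<open>symmetric_form.unstable_if_linearization_increases\<close>).

  Stability also asserts that solutions exist for all future times. Composing the field with the
  closest-point projection onto a small ball makes it bounded and globally Lipschitz, so that global
  solutions come from a contraction (\<open>global_solution_exists\<close>); the Lyapunov function keeps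
  them inside the ball, where the field is the original one.
\<close>

section \<open>Global solutions of bounded Lipschitz systems\<close>

lemma integral_exp_le:
  fixes K \<tau> :: real
  assumes "K > 0" "\<tau> \<ge> 0"
  shows "(\<lambda>\<sigma>. exp (K * \<sigma>)) integrable_on {0..\<tau>}"
    and "integral {0..\<tau>} (\<lambda>\<sigma>. exp (K * \<sigma>)) \<le> exp (K * \<tau>) / K"
proof -
  have "((\<lambda>\<sigma>. exp (K * \<sigma>)) has_integral (exp (K * \<tau>) / K - exp (K * 0) / K)) {0..\<tau>}"
  proof (rule fundamental_theorem_of_calculus)
    show "((\<lambda>\<sigma>. exp (K * \<sigma>) / K) has_vector_derivative exp (K * \<sigma>)) (at \<sigma> within {0..\<tau>})" for \<sigma>
      using assms(1) unfolding has_real_derivative_iff_has_vector_derivative [symmetric]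
      by (auto intro!: derivative_eq_intros)
  qed (use assms in auto)
  then show "(\<lambda>\<sigma>. exp (K * \<sigma>)) integrable_on {0..\<tau>}"
    and "integral {0..\<tau>} (\<lambda>\<sigma>. exp (K * \<sigma>)) \<le> exp (K * \<tau>) / K"
    using assms(1) by (auto simp: integral_unique)
qed

text \<open>
  Substituting $x(t) = x_0 + e^{Kt} u(t)$ with $u$ bounded turns the integral equation into a fixed
  point problem for bounded continuous $u$. The weight $e^{Kt}$ makes the integral operator
  a contraction with factor $L/K$ on the whole half-line, so one application of Banach's theorem
  gives the solution for all times.
\<close>
theorem global_solution_exists:
  fixes f :: "'a::banach \<Rightarrow> 'a"
  assumes lip: "L-lipschitz_on UNIV f" and bdd: "\<And>x. norm (f x) \<le> C"
  obtains x where "solution_on f UNIV {0..} x" "x 0 = x0"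
proof -
  \<comment> \<open>\<open>K \<ge> 2 L\<close> gives the contraction factor \<open>1/2\<close>; adding \<open>2\<close> keeps \<open>K\<close> positive when \<open>L = 0\<close>.\<close>
  define K where "K = 2 * L + 2"
  have L: "L \<ge> 0" using lip by (rule lipschitz_on_nonneg)
  have K: "K > 0" "L / K \<le> 1/2" using L by (auto simp: K_def field_simps)
  have C: "C \<ge> 0" using bdd[of 0] norm_ge_zero order_trans by blast
  have contf: "continuous_on UNIV f" using lip by (rule lipschitz_on_continuous_on)
  define y where "y = (\<lambda>(u::real \<Rightarrow>\<^sub>C 'a) t. x0 + exp (K * t) *\<^sub>R u t)"
  \<comment> \<open>Bounded continuous functions live on all of the real line, so \<open>\<Phi> u\<close> is extended by a constant to negative times.\<close>
  define \<Phi> where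
    "\<Phi> = (\<lambda>u t. exp (- K * max 0 t) *\<^sub>R integral {0..max 0 t} (\<lambda>\<sigma>. f (y u \<sigma>)))"
  have conty: "continuous_on S (\<lambda>t. f (y u t))" for u S
    unfolding y_def
    by (rule continuous_on_compose2[OF contf]) (auto intro!: continuous_intros)
  have inty: "(\<lambda>t. f (y u t)) integrable_on {0..b}" for u b
    by (intro integrable_continuous_real conty)
  have primitive: "((\<lambda>t. integral {0..t} (\<lambda>\<sigma>. f (y u \<sigma>))) has_vector_derivative f (y u t)) (at t within {0..})"
    if "t \<ge> 0" for u t
  proof -
    have "((\<lambda>t. integral {0..t} (\<lambda>\<sigma>. f (y u \<sigma>))) has_vector_derivative f (y u t)) (at t within {0..t+1})"
      using that by (intro integral_has_vector_derivative conty) auto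
    moreover have "at t within {0..t+1} = at t within {0..}"
      by (rule at_within_nhd[of _ "{..<t+1}"]) auto
    ultimately show ?thesis by simp
  qed
  have bc: "\<Phi> u \<in> bcontfun" for u
  proof (rule bcontfun_normI)
    have "continuous_on {0..} (\<lambda>t. integral {0..t} (\<lambda>\<sigma>. f (y u \<sigma>)))"
      using primitive by (meson atLeast_iff continuous_on_eq_continuous_within has_vector_derivative_continuous)
    then have "continuous_on UNIV (\<lambda>t. integral {0..max 0 t} (\<lambda>\<sigma>. f (y u \<sigma>)))"
      by (rule continuous_on_compose2) (auto intro!: continuous_intros)
    then show "continuous_on UNIV (\<Phi> u)"
      unfolding \<Phi>_def by (intro continuous_intros)
    fix t :: real
    define \<tau> where "\<tau> = max 0 t"
    have \<tau>: "\<tau> \<ge> 0" by (simp add: \<tau>_def)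
    have "norm (integral {0..\<tau>} (\<lambda>\<sigma>. f (y u \<sigma>))) \<le> C * (\<tau> - 0)"
      using \<tau> bdd conty by (intro integral_bound) auto
    moreover have "K * \<tau> \<le> exp (K * \<tau>)" using exp_ge_add_one_self[of "K * \<tau>"] by linarith
    ultimately have "norm (integral {0..\<tau>} (\<lambda>\<sigma>. f (y u \<sigma>))) \<le> C / K * exp (K * \<tau>)"
      using K C \<tau> by (smt (verit) divide_pos_pos mult_left_mono nonzero_mult_div_cancel_left
            times_divide_eq_left times_divide_eq_right divide_right_mono)
    then have "exp (- K * \<tau>) * norm (integral {0..\<tau>} (\<lambda>\<sigma>. f (y u \<sigma>)))
        \<le> exp (- K * \<tau>) * (C / K * exp (K * \<tau>))"
      by (intro mult_left_mono) auto
    then show "norm (\<Phi> u t) \<le> C / K"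
      by (simp add: \<Phi>_def \<tau>_def [symmetric] exp_minus field_simps)
  qed
  have app: "apply_bcontfun (Bcontfun (\<Phi> u)) = \<Phi> u" for u
    using bc by (simp add: Bcontfun_inverse)
  have contr: "dist (Bcontfun (\<Phi> u)) (Bcontfun (\<Phi> v)) \<le> 1/2 * dist u v" for u v
  proof (rule dist_bound)
    fix t :: real
    define \<tau> where "\<tau> = max 0 t"
    have \<tau>: "\<tau> \<ge> 0" by (simp add: \<tau>_def)
    let ?d = "dist u v"
    have "norm (f (y u \<sigma>) - f (y v \<sigma>)) \<le> L * ?d * exp (K * \<sigma>)" for \<sigma>
    proof -
      have "norm (f (y u \<sigma>) - f (y v \<sigma>)) \<le> L * norm (y u \<sigma> - y v \<sigma>)"
        using lipschitz_onD[OF lip] by (auto simp: dist_norm)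
      also have "y u \<sigma> - y v \<sigma> = exp (K * \<sigma>) *\<^sub>R (u \<sigma> - v \<sigma>)"
        by (simp add: y_def algebra_simps)
      also have "L * norm \<dots> \<le> L * (exp (K * \<sigma>) * ?d)"
        using dist_bounded[of u \<sigma> v] L by (intro mult_left_mono) (simp_all add: dist_norm)
      finally show ?thesis by (simp add: mult_ac)
    qed
    then have "norm (integral {0..\<tau>} (\<lambda>\<sigma>. f (y u \<sigma>) - f (y v \<sigma>)))
        \<le> integral {0..\<tau>} (\<lambda>\<sigma>. L * ?d * exp (K * \<sigma>))"
      using integral_exp_le(1)[OF K(1) \<tau>]
      by (intro integral_norm_bound_integral integrable_diff inty integrable_on_mult_right) auto
    also have "\<dots> = L * ?d * integral {0..\<tau>} (\<lambda>\<sigma>. exp (K * \<sigma>))" by simp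
    also have "\<dots> \<le> L * ?d * (exp (K * \<tau>) / K)"
      using integral_exp_le(2)[OF K(1) \<tau>] L by (intro mult_left_mono) auto
    also have "\<dots> = L / K * (?d * exp (K * \<tau>))" by simp
    also have "\<dots> \<le> 1/2 * (?d * exp (K * \<tau>))" using K(2) by (intro mult_right_mono) auto
    finally have "exp (- K * \<tau>) * norm (integral {0..\<tau>} (\<lambda>\<sigma>. f (y u \<sigma>) - f (y v \<sigma>)))
        \<le> exp (- K * \<tau>) * (1/2 * (?d * exp (K * \<tau>)))"
      by (intro mult_left_mono) auto
    also have "\<dots> = 1/2 * ?d" by (simp add: exp_minus field_simps)
    finally have "norm (\<Phi> u t - \<Phi> v t) \<le> 1/2 * ?d"
      by (simp add: \<Phi>_def \<tau>_def [symmetric] integral_diff inty flip: scaleR_diff_right)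
    then show "dist (apply_bcontfun (Bcontfun (\<Phi> u)) t) (apply_bcontfun (Bcontfun (\<Phi> v)) t) \<le> 1/2 * ?d"
      by (simp add: app dist_norm)
  qed
  have "\<exists>!u. Bcontfun (\<Phi> u) = u"
    using contr by (intro banach_fix_type[of "1/2"]) auto
  then obtain u where "Bcontfun (\<Phi> u) = u" by blast
  then have u: "apply_bcontfun u = \<Phi> u" using app by metis
  have yu: "y u t = x0 + integral {0..t} (\<lambda>\<sigma>. f (y u \<sigma>))" if "t \<ge> 0" for t
  proof -
    have "y u t = x0 + exp (K * t) *\<^sub>R \<Phi> u t" by (simp only: y_def u)
    then show ?thesis using that by (simp add: \<Phi>_def exp_minus)
  qed
  have "(y u has_vector_derivative f (y u t)) (at t within {0..})" if t: "t \<ge> 0" for t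
  proof -
    have "((\<lambda>t. x0 + integral {0..t} (\<lambda>\<sigma>. f (y u \<sigma>))) has_vector_derivative f (y u t)) (at t within {0..})"
      using has_vector_derivative_add[OF has_vector_derivative_const primitive[OF t]] by simp
    from has_vector_derivative_transform[OF _ _ this, of "y u"] yu t show ?thesis
      by (metis atLeast_iff)
  qed
  moreover have "y u 0 = x0" using yu[of 0] by simp
  ultimately show ?thesis using that[of "y u"] by (simp add: solution_on_def)
qed

section \<open>Quadratic forms along solutions\<close>

lemma solution_on_subset:
  assumes "solution_on f X J x" "J' \<subseteq> J"
  shows "solution_on f X J' x"
  using assms by (auto simp: solution_on_def intro: has_vector_derivative_within_subset)

text \<open>
  The factor $e^{-kt}$ removes the linear term, leaving a nonincreasing function. With $k = 0$ this
  is monotonicity, with $k < 0$ exponential decay, and applied to $-v$ exponential growth.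
\<close>
lemma exponential_comparison:
  fixes v :: "real \<Rightarrow> real"
  assumes "0 \<le> T" "continuous_on {0..T} v"
    and "\<And>t. \<lbrakk>0 < t; t < T\<rbrakk> \<Longrightarrow> (v has_real_derivative v' t) (at t)"
    and "\<And>t. \<lbrakk>0 < t; t < T\<rbrakk> \<Longrightarrow> v' t \<le> k * v t"
  shows "v T \<le> exp (k * T) * v 0"
proof -
  have "exp (- k * T) * v T \<le> exp (- k * 0) * v 0"
  proof (rule DERIV_nonpos_imp_decreasing_open[of _ _ "\<lambda>t. exp (- k * t) * v t"])
    fix t assume t: "0 < t" "t < T"
    have "((\<lambda>t. exp (- k * t) * v t) has_real_derivative exp (- k * t) * (v' t - k * v t)) (at t)"
      using assms(3)[OF t] by (auto intro!: derivative_eq_intros simp: algebra_simps)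
    moreover have "exp (- k * t) * (v' t - k * v t) \<le> 0"
      using assms(4)[OF t] by (simp add: mult_nonneg_nonpos)
    ultimately show "\<exists>y. ((\<lambda>t. exp (- k * t) * v t) has_real_derivative y) (at t) \<and> y \<le> 0" by blast
  qed (use assms in \<open>auto intro!: continuous_intros\<close>)
  then show ?thesis by (simp add: exp_minus field_simps)
qed

text \<open>
  The associated quadratic form changes along a solution of $x' = f(x)$ at the rate
  $2 B(x - P, f(x))$; for $f(x) = A (x - P)$
  its growth or decay is thus decided by the sign of $v \mapsto B(v, A v)$.
\<close>
locale symmetric_form = bounded_bilinear B for B :: "'a::euclidean_space \<Rightarrow> 'a \<Rightarrow> real" +
  assumes sym: "B u v = B v u"
begin

lemma upper_bound: obtains C where "C > 0" "\<And>u v. \<bar>B u v\<bar> \<le> C * norm u * norm v"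
  using pos_bounded by (metis mult.assoc mult.commute real_norm_def)

lemma along_solution:
  assumes "solution_on f X {0..T} x"
  shows "continuous_on {0..T} (\<lambda>t. B (x t - P) (x t - P))"
    and "\<lbrakk>0 < t; t < T\<rbrakk> \<Longrightarrow>
      ((\<lambda>t. B (x t - P) (x t - P)) has_real_derivative 2 * B (x t - P) (f (x t))) (at t)"
proof -
  have d: "((\<lambda>t. B (x t - P) (x t - P)) has_vector_derivative
      B (x t - P) (f (x t) - 0) + B (f (x t) - 0) (x t - P)) (at t within {0..T})" if "t \<in> {0..T}" for t
    using assms that unfolding solution_on_def
    by (intro has_vector_derivative has_vector_derivative_diff has_vector_derivative_const) auto
  then show "continuous_on {0..T} (\<lambda>t. B (x t - P) (x t - P))"
    by (meson continuous_on_eq_continuous_within has_vector_derivative_continuous)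
  assume t: "0 < t" "t < T"
  then have "at t within {0..T} = at t" by (intro at_within_interior) auto
  with d[of t] t show "((\<lambda>t. B (x t - P) (x t - P)) has_real_derivative 2 * B (x t - P) (f (x t))) (at t)"
    by (simp add: has_real_derivative_iff_has_vector_derivative sym[of "f (x t)"])
qed

text \<open>
  On the sphere of radius $r$ the form is at least $c r^2$. Up to the first time at which a solution
  reaches that sphere the form does not increase, so a start below $c r^2$ never gets there.
\<close>
lemma sublevel_trapping:
  assumes sol: "solution_on f X {0..T} x" and "T \<ge> 0" and "r > 0" and "c > 0"
    and pos: "\<And>v. c * (norm v)\<^sup>2 \<le> B v v"
    and decr: "\<And>y. y \<in> ball P r \<Longrightarrow> B (y - P) (f y) \<le> 0"
    and init: "B (x 0 - P) (x 0 - P) < c * r\<^sup>2"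
  shows "dist (x T) P < r"
proof (rule ccontr)
  assume "\<not> dist (x T) P < r"
  define Z where "Z = {t\<in>{0..T}. r \<le> dist (x t) P}"
  have contx: "continuous_on {0..T} x"
    using sol by (auto simp: solution_on_def continuous_on_eq_continuous_within
        intro: has_vector_derivative_continuous)
  have "T \<in> Z" using \<open>T \<ge> 0\<close> \<open>\<not> dist (x T) P < r\<close> by (simp add: Z_def)
  moreover have "closed Z" unfolding Z_def
    by (intro continuous_on_closed_Collect_le continuous_intros contx)
  moreover have "bdd_below Z" by (auto simp: Z_def intro: bdd_belowI)
  ultimately have "Inf Z \<in> Z" by (intro closed_contains_Inf) auto
  define t1 where "t1 = Inf Z"
  have t1: "0 \<le> t1" "t1 \<le> T" "r \<le> dist (x t1) P"
    using \<open>Inf Z \<in> Z\<close> by (auto simp: Z_def t1_def)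
  have before: "x t \<in> ball P r" if "0 < t" "t < t1" for t
  proof -
    have "t \<notin> Z" using that \<open>bdd_below Z\<close> cInf_lower[of t Z] by (auto simp: t1_def)
    then show ?thesis using that t1 by (auto simp: Z_def dist_commute)
  qed
  have sol1: "solution_on f X {0..t1} x" using t1 by (intro solution_on_subset[OF sol]) auto
  have "B (x t1 - P) (x t1 - P) \<le> exp (0 * t1) * B (x 0 - P) (x 0 - P)"
    by (rule exponential_comparison[OF t1(1) along_solution[OF sol1]])
      (use before decr in auto)
  moreover have "c * r\<^sup>2 \<le> c * (norm (x t1 - P))\<^sup>2"
    using t1 \<open>c > 0\<close> \<open>r > 0\<close> by (auto simp: dist_norm intro!: mult_left_mono power_mono)
  ultimately show False using pos[of "x t1 - P"] init by simp
qed

end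

section \<open>Definite quadratic forms\<close>

lemma positive_quadratic_lower_bound:
  fixes q :: "'a::euclidean_space \<Rightarrow> real"
  assumes cont: "continuous_on UNIV q" and hom: "\<And>t v. q (t *\<^sub>R v) = t\<^sup>2 * q v"
    and pos: "\<And>v. v \<noteq> 0 \<Longrightarrow> q v > 0"
  obtains c where "c > 0" "\<And>v. c * (norm v)\<^sup>2 \<le> q v"
proof -
  have "continuous_on (sphere 0 1) q" using cont by (rule continuous_on_subset) auto
  then obtain w where w: "w \<in> sphere 0 1" "\<And>v. v \<in> sphere 0 1 \<Longrightarrow> q w \<le> q v"
    using continuous_attains_inf[of "sphere 0 1" q] by auto
  have "q w * (norm v)\<^sup>2 \<le> q v" for v
  proof (cases "v = 0")
    case False
    then have "q w \<le> q ((1 / norm v) *\<^sub>R v)" by (intro w(2)) simp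
    then show ?thesis using False by (simp add: hom field_simps)
  qed (use hom[of 0 0] in simp)
  moreover have "q w > 0" using w(1) by (intro pos) auto
  ultimately show ?thesis using that by blast
qed

text \<open>
  Finsler's lemma. On the unit sphere the set where $q_1 \le 0$ is compact and $q_0$ is positive on it,
  hence bounded away from $0$, and a large multiple of $q_0$ outweighs $q_1$ there. Elsewhere on the
  sphere $q_1$ is already positive.
\<close>
lemma finsler:
  fixes q\<^sub>0 q\<^sub>1 :: "'a::euclidean_space \<Rightarrow> real"
  assumes cont: "continuous_on UNIV q\<^sub>0" "continuous_on UNIV q\<^sub>1"
    and hom: "\<And>t v. q\<^sub>0 (t *\<^sub>R v) = t\<^sup>2 * q\<^sub>0 v" "\<And>t v. q\<^sub>1 (t *\<^sub>R v) = t\<^sup>2 * q\<^sub>1 v"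
    and nonneg: "\<And>v. q\<^sub>0 v \<ge> 0" and pos: "\<And>v. \<lbrakk>v \<noteq> 0; q\<^sub>0 v = 0\<rbrakk> \<Longrightarrow> q\<^sub>1 v > 0"
  obtains K\<^sub>0 where "\<And>K v. \<lbrakk>K \<ge> K\<^sub>0; v \<noteq> 0\<rbrakk> \<Longrightarrow> K * q\<^sub>0 v + q\<^sub>1 v > 0"
proof -
  define Z where "Z = {v \<in> sphere 0 1. q\<^sub>1 v \<le> 0}"
  have "closed Z" unfolding Z_def
    by (intro continuous_on_closed_Collect_le continuous_on_subset[OF cont(2)] continuous_intros) auto
  then have Z: "compact Z"
    by (intro compact_eq_bounded_closed[THEN iffD2] conjI bounded_subset[OF bounded_sphere[of 0 1]])
      (auto simp: Z_def)
  have *: "\<exists>K\<^sub>0\<ge>0. \<forall>v\<in>Z. K\<^sub>0 * q\<^sub>0 v + q\<^sub>1 v > 0"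
  proof (cases "Z = {}")
    case False
    have "continuous_on Z q\<^sub>0" "continuous_on Z q\<^sub>1" using cont continuous_on_subset by blast+
    from continuous_attains_inf[OF Z False this(1)] continuous_attains_inf[OF Z False this(2)]
    obtain v0 v1 where v0: "v0 \<in> Z" "\<And>v. v \<in> Z \<Longrightarrow> q\<^sub>0 v0 \<le> q\<^sub>0 v"
      and v1: "v1 \<in> Z" "\<And>v. v \<in> Z \<Longrightarrow> q\<^sub>1 v1 \<le> q\<^sub>1 v"
      by blast
    have "v0 \<noteq> 0" "q\<^sub>1 v0 \<le> 0" using v0(1) by (auto simp: Z_def)
    then have q0: "q\<^sub>0 v0 > 0" using nonneg[of v0] pos[of v0] by linarith
    have q1: "q\<^sub>1 v1 \<le> 0" using v1(1) by (simp add: Z_def)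
    let ?K = "(1 - q\<^sub>1 v1) / q\<^sub>0 v0"
    have "?K * q\<^sub>0 v + q\<^sub>1 v > 0" if "v \<in> Z" for v
    proof -
      have "1 - q\<^sub>1 v1 = ?K * q\<^sub>0 v0" using q0 by simp
      also have "\<dots> \<le> ?K * q\<^sub>0 v" using q0 q1 v0(2)[OF that] by (intro mult_left_mono) auto
      finally show ?thesis using v1(2)[OF that] by linarith
    qed
    then show ?thesis using q0 q1 by (intro exI[of _ ?K]) auto
  qed auto
  then obtain K\<^sub>0 where K0: "K\<^sub>0 \<ge> 0" "\<And>v. v \<in> Z \<Longrightarrow> K\<^sub>0 * q\<^sub>0 v + q\<^sub>1 v > 0" by blast
  have "K * q\<^sub>0 v + q\<^sub>1 v > 0" if K: "K \<ge> K\<^sub>0" and v: "v \<noteq> 0" for K v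
  proof -
    define u where "u = (1 / norm v) *\<^sub>R v"
    have u: "u \<in> sphere 0 1" "v = norm v *\<^sub>R u" using v by (auto simp: u_def)
    have "K * q\<^sub>0 u + q\<^sub>1 u > 0"
    proof (cases "u \<in> Z")
      case True
      then show ?thesis using K0(2)[OF True] mult_right_mono[OF K nonneg[of u]] by linarith
    next
      case False
      then have "q\<^sub>1 u > 0" using u(1) by (auto simp: Z_def)
      then show ?thesis using K K0(1) nonneg[of u] by (simp add: add_nonneg_pos)
    qed
    moreover have "K * q\<^sub>0 v + q\<^sub>1 v = (norm v)\<^sup>2 * (K * q\<^sub>0 u + q\<^sub>1 u)"
      using hom(1)[of "norm v" u] hom(2)[of "norm v" u] by (simp add: u(2)[symmetric] algebra_simps)
    ultimately show ?thesis using v by simp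
  qed
  then show ?thesis using that by blast
qed

section \<open>Strict derivatives\<close>

text \<open>
  Two points near $P$ are compared with each other, not only with $P$. This one notion yields the
  Lipschitz condition near $P$ needed to construct solutions as well as the smallness of the
  nonlinear remainder at $P$.
\<close>
definition strict_derivative_at ::
  "('a::real_normed_vector \<Rightarrow> 'b::real_normed_vector) \<Rightarrow> ('a \<Rightarrow> 'b) \<Rightarrow> 'a \<Rightarrow> bool" where
  "strict_derivative_at f A P \<longleftrightarrow> bounded_linear A \<and>
     (\<forall>\<epsilon>>0. \<exists>r>0. \<forall>x\<in>cball P r. \<forall>y\<in>cball P r. norm (f x - f y - A (x - y)) \<le> \<epsilon> * norm (x - y))"

lemma strict_derivative_at_lipschitz:
  assumes "strict_derivative_at f A P"
  obtains L r where "r > 0" "L-lipschitz_on (cball P r) f"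
proof -
  from assms have A: "bounded_linear A" by (simp add: strict_derivative_at_def)
  obtain r where r: "r > 0"
    "\<And>x y. x \<in> cball P r \<Longrightarrow> y \<in> cball P r \<Longrightarrow> norm (f x - f y - A (x - y)) \<le> 1 * norm (x - y)"
    using assms unfolding strict_derivative_at_def by (meson zero_less_one)
  have "(1 + onorm A)-lipschitz_on (cball P r) f"
  proof (rule lipschitz_onI)
    fix x y assume "x \<in> cball P r" "y \<in> cball P r"
    from r(2)[OF this] onorm[OF A, of "x - y"]
    show "dist (f x) (f y) \<le> (1 + onorm A) * dist x y"
      using norm_triangle_ineq[of "f x - f y - A (x - y)" "A (x - y)"]
      by (simp add: dist_norm algebra_simps)
  qed (use onorm_pos_le[OF A] in simp)
  with r(1) show ?thesis using that by blast
qed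

section \<open>Stability and instability from the linearization\<close>

context symmetric_form
begin

text \<open>
  The rate of the form differs from that of the linearization by a term of higher order, which any
  definite rate absorbs in a small ball.
\<close>
lemma remainder_bound:
  assumes "strict_derivative_at f A P" "f P = 0" "k > 0"
  obtains r where "r > 0"
    "\<And>y. y \<in> cball P r \<Longrightarrow> \<bar>B (y - P) (f y) - B (y - P) (A (y - P))\<bar> \<le> k * (norm (y - P))\<^sup>2"
proof -
  obtain C where C: "C > 0" "\<And>u v. \<bar>B u v\<bar> \<le> C * norm u * norm v" using upper_bound by blast
  obtain r where r: "r > 0"
    "\<And>x y. x \<in> cball P r \<Longrightarrow> y \<in> cball P r \<Longrightarrow> norm (f x - f y - A (x - y)) \<le> k / C * norm (x - y)"
    using assms(1) divide_pos_pos[OF assms(3) C(1)] unfolding strict_derivative_at_def by blast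
  have "\<bar>B (y - P) (f y) - B (y - P) (A (y - P))\<bar> \<le> k * (norm (y - P))\<^sup>2" if y: "y \<in> cball P r" for y
  proof -
    have "\<bar>B (y - P) (f y) - B (y - P) (A (y - P))\<bar> = \<bar>B (y - P) (f y - f P - A (y - P))\<bar>"
      using assms(2) by (simp add: diff_right)
    also have "\<dots> \<le> C * norm (y - P) * norm (f y - f P - A (y - P))" by (rule C)
    also have "\<dots> \<le> C * norm (y - P) * (k / C * norm (y - P))"
      using r y C(1) by (intro mult_left_mono) auto
    also have "\<dots> = k * (norm (y - P))\<^sup>2" using C(1) by (simp add: power2_eq_square)
    finally show ?thesis .
  qed
  with r(1) show ?thesis by (rule that)
qed

lemma definite_lower_bound:
  assumes A: "bounded_linear A" and pos: "\<And>v. v \<noteq> 0 \<Longrightarrow> B v (A v) > 0"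
  obtains c where "c > 0" "\<And>v. c * (norm v)\<^sup>2 \<le> B v (A v)"
proof (rule positive_quadratic_lower_bound[of "\<lambda>v. B v (A v)"])
  show "continuous_on UNIV (\<lambda>v. B v (A v))"
    by (intro continuous_on continuous_intros bounded_linear.continuous_on[OF A])
  show "B (t *\<^sub>R v) (A (t *\<^sub>R v)) = t\<^sup>2 * B v (A v)" for t v
    by (simp add: linear_scale[OF bounded_linear.linear[OF A]] scaleR_left scaleR_right power2_eq_square)
qed (use pos that in auto)

text \<open>
  Lyapunov's theorem. In a small ball the rate of the form is at most a negative multiple of the
  form itself. Its sublevel sets therefore trap solutions, which gives stability and, with the
  projected field, existence for all times; and the form decays exponentially, which
  gives attraction.
\<close>
theorem asymptotically_stable_if_linearization_decreases:
  assumes eq: "equilibrium_point f X P" and int: "P \<in> interior X"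
    and der: "strict_derivative_at f A P"
    and pos: "\<And>v. v \<noteq> 0 \<Longrightarrow> B v v > 0"
    and neg: "\<And>v. v \<noteq> 0 \<Longrightarrow> B v (A v) < 0"
  shows "asymptotically_stable f X P"
proof -
  have A: "bounded_linear A" using der by (simp add: strict_derivative_at_def)
  obtain c where c: "c > 0" "\<And>v. c * (norm v)\<^sup>2 \<le> B v v"
    using definite_lower_bound[OF bounded_linear_ident pos] by blast
  have "B v (- A v) > 0" if "v \<noteq> 0" for v using neg[OF that] by (simp add: minus_right)
  then obtain k where k: "k > 0" "\<And>v. k * (norm v)\<^sup>2 \<le> B v (- A v)"
    using definite_lower_bound[OF bounded_linear_minus[OF A]] by blast
  have k': "B v (A v) \<le> - k * (norm v)\<^sup>2" for v
    using k(2)[of v] by (simp add: minus_right)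
  have fP: "f P = 0" using eq by (simp add: equilibrium_point_def)
  obtain C where C: "C > 0" "\<And>u v. \<bar>B u v\<bar> \<le> C * norm u * norm v" using upper_bound by blast
  have BC: "B v v \<le> C * (norm v)\<^sup>2" for v
    using C(2)[of v v] by (simp add: power2_eq_square mult.assoc)
  obtain r1 where r1: "r1 > 0"
    "\<And>y. y \<in> cball P r1 \<Longrightarrow> \<bar>B (y - P) (f y) - B (y - P) (A (y - P))\<bar> \<le> k/2 * (norm (y - P))\<^sup>2"
    using remainder_bound[OF der fP, of "k/2"] k(1) by auto
  obtain r2 L where r2: "r2 > 0" "L-lipschitz_on (cball P r2) f"
    using strict_derivative_at_lipschitz[OF der] by metis
  obtain r3 where r3: "r3 > 0" "cball P r3 \<subseteq> X"
    using int mem_interior_cball by blast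
  define r where "r = min r1 (min r2 r3)"
  have r: "r > 0" "cball P r \<subseteq> X" "L-lipschitz_on (cball P r) f"
    using r1(1) r2 r3 by (auto simp: r_def intro: lipschitz_on_subset)
  have decr: "B (y - P) (f y) \<le> - (k/2) * (norm (y - P))\<^sup>2" if "y \<in> cball P r" for y
  proof -
    have "y \<in> cball P r1" using that by (simp add: r_def)
    from r1(2)[OF this] k'[of "y - P"] show ?thesis by linarith
  qed
  have decr0: "B (y - P) (f y) \<le> 0" if "y \<in> cball P r" for y
    using order_trans[OF decr[OF that], of 0] k(1) by simp
  \<comment> \<open>A start within \<open>radius \<epsilon>\<close> puts the form below \<open>c \<epsilon>\<^sup>2\<close>, hence below its values on the sphere of radius \<open>\<epsilon>\<close>.\<close>
  define radius where "radius = (\<lambda>\<epsilon>. \<epsilon> * sqrt (c / C))"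
  have radius: "radius \<epsilon> > 0" if "\<epsilon> > 0" for \<epsilon>
    using that c(1) C(1) by (simp add: radius_def)
  have init: "B (y - P) (y - P) < c * \<epsilon>\<^sup>2" if "dist y P < radius \<epsilon>" "\<epsilon> > 0" for y \<epsilon>
  proof -
    have "(norm (y - P))\<^sup>2 < (radius \<epsilon>)\<^sup>2"
      using that by (intro power_strict_mono) (auto simp: dist_norm)
    then have "C * (norm (y - P))\<^sup>2 < c * \<epsilon>\<^sup>2"
      using c(1) C(1) by (simp add: radius_def power_mult_distrib field_simps)
    then show ?thesis using BC[of "y - P"] by linarith
  qed
  \<comment> \<open>The field may differ from \<open>f\<close> outside the ball, so that this also covers the projected field below.\<close>
  have trapped: "dist (x t) P < \<epsilon>"
    if "solution_on f' Y {0..t} x" "t \<ge> 0" "dist (x 0) P < radius \<epsilon>" "0 < \<epsilon>" "\<epsilon> \<le> r"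
      "\<And>y. y \<in> cball P r \<Longrightarrow> f' y = f y" for f' Y x t \<epsilon>
  proof (rule sublevel_trapping[OF that(1,2,4) c _ init[OF that(3,4)]])
    fix y assume "y \<in> ball P \<epsilon>"
    then have "y \<in> cball P r" using that(5) by simp
    then show "B (y - P) (f' y) \<le> 0" using decr0 that(6) by simp
  qed
  have exists: "\<exists>x. solution_on f X {0..} x \<and> x 0 = x0" if "dist x0 P < radius r" for x0
  proof -
    let ?p = "closest_point (cball P r)"
    have p: "?p y \<in> cball P r" for y using r(1) by (intro closest_point_in_set) auto
    have pid: "?p y = y" if "y \<in> cball P r" for y using that by (rule closest_point_self)
    have "1-lipschitz_on UNIV ?p"
      using r(1) by (intro lipschitz_onI) (auto intro!: closest_point_lipschitz)
    then have "(L * 1)-lipschitz_on UNIV (\<lambda>y. f (?p y))"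
      using r(3) p by (intro lipschitz_on_compose2) (auto intro: lipschitz_on_subset)
    moreover have "norm (f (?p y)) \<le> L * r" for y
    proof -
      have "norm (f (?p y)) \<le> L * dist (?p y) P"
        using lipschitz_onD[OF r(3) p, of P y] r(1) fP by (simp add: dist_norm)
      also have "\<dots> \<le> L * r"
        using p[of y] lipschitz_on_nonneg[OF r(3)] by (intro mult_left_mono) (auto simp: dist_commute)
      finally show ?thesis .
    qed
    ultimately obtain x where x: "solution_on (\<lambda>y. f (?p y)) UNIV {0..} x" "x 0 = x0"
      using global_solution_exists by blast
    have "x t \<in> cball P r" if "t \<ge> 0" for t
    proof -
      have "dist (x t) P < r"
        by (rule trapped[OF solution_on_subset[OF x(1)]])
          (use that x(2) r(1) \<open>dist x0 P < radius r\<close> pid in auto)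
      then show ?thesis by (simp add: dist_commute)
    qed
    then have "solution_on f X {0..} x"
      using x(1) r(2) pid by (auto simp: solution_on_def)
    with x(2) show ?thesis by blast
  qed
  have "lyapunov_stable f X P"
    unfolding lyapunov_stable_def
  proof (intro conjI eq allI impI)
    fix \<epsilon> :: real assume "\<epsilon> > 0"
    define \<epsilon>' where "\<epsilon>' = min \<epsilon> r"
    have \<epsilon>': "0 < \<epsilon>'" "\<epsilon>' \<le> \<epsilon>" "\<epsilon>' \<le> r" using \<open>\<epsilon> > 0\<close> r(1) by (auto simp: \<epsilon>'_def)
    then have "radius \<epsilon>' \<le> radius r"
      using c(1) C(1) by (auto simp: radius_def intro!: mult_right_mono)
    with \<epsilon>' show "\<exists>\<delta>>0. \<forall>x0\<in>X. dist x0 P < \<delta> \<longrightarrow>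
        (\<exists>x. solution_on f X {0..} x \<and> x 0 = x0) \<and>
        (\<forall>T>0. \<forall>x. solution_on f X {0..<T} x \<and> x 0 = x0 \<longrightarrow>
           (\<forall>t\<in>{0..<T}. dist (x t) P < \<epsilon>))"
    proof (intro exI[of _ "radius \<epsilon>'"] conjI ballI impI allI)
      show "radius \<epsilon>' > 0" using \<epsilon>'(1) by (rule radius)
      fix x0 assume x0: "dist x0 P < radius \<epsilon>'"
      then show "\<exists>x. solution_on f X {0..} x \<and> x 0 = x0"
        using \<open>radius \<epsilon>' \<le> radius r\<close> by (intro exists) simp
      fix T x t
      assume x: "solution_on f X {0..<T} x \<and> x 0 = x0" and t: "t \<in> {0..<T}"
      then have "solution_on f X {0..t} x" by (auto intro!: solution_on_subset[of f X "{0..<T}"])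
      then have "dist (x t) P < \<epsilon>'" by (rule trapped) (use x t x0 \<epsilon>' in auto)
      then show "dist (x t) P < \<epsilon>" using \<epsilon>' by simp
    qed
  qed
  moreover have "(x \<longlongrightarrow> P) at_top" if x: "solution_on f X {0..} x" "dist (x 0) P < radius r" for x
  proof -
    have inball: "x t \<in> cball P r" if "t \<ge> 0" for t
    proof -
      have "dist (x t) P < r"
        by (rule trapped[OF solution_on_subset[OF x(1)]]) (use that x(2) r(1) in auto)
      then show ?thesis by (simp add: dist_commute)
    qed
    let ?V = "\<lambda>t. B (x t - P) (x t - P)"
    have bound: "(norm (x t - P))\<^sup>2 \<le> ?V 0 / c * exp (- (k / C) * t)" if "t \<ge> 0" for t
    proof -
      have sol: "solution_on f X {0..t} x" by (rule solution_on_subset[OF x(1)]) auto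
      have "?V t \<le> exp (- (k / C) * t) * ?V 0"
      proof (rule exponential_comparison[OF that along_solution[OF sol]])
        fix \<tau> assume "0 < \<tau>" "\<tau> < t"
        then have "2 * B (x \<tau> - P) (f (x \<tau>)) \<le> - k * (norm (x \<tau> - P))\<^sup>2"
          using decr[OF inball, of \<tau>] by simp
        also have "\<dots> = - (k / C) * (C * (norm (x \<tau> - P))\<^sup>2)" using C(1) by simp
        also have "\<dots> \<le> - (k / C) * ?V \<tau>"
          using BC[of "x \<tau> - P"] k(1) C(1) by (intro mult_left_mono_neg) auto
        finally show "2 * B (x \<tau> - P) (f (x \<tau>)) \<le> - (k / C) * ?V \<tau>" .
      qed
      then have "c * (norm (x t - P))\<^sup>2 \<le> exp (- (k / C) * t) * ?V 0"
        by (rule order_trans[OF c(2)])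
      then show ?thesis using c(1) by (simp add: field_simps)
    qed
    have "filterlim (\<lambda>t. - (k / C) * t) at_bot at_top"
      using k(1) C(1) by (intro filterlim_tendsto_neg_mult_at_bot[OF tendsto_const _ filterlim_ident]) auto
    then have "((\<lambda>t. exp (- (k / C) * t)) \<longlongrightarrow> 0) at_top"
      by (rule filterlim_compose[OF exp_at_bot])
    then have upper: "((\<lambda>t. ?V 0 / c * exp (- (k / C) * t)) \<longlongrightarrow> 0) at_top"
      by (rule tendsto_mult_right_zero)
    have "((\<lambda>t. (norm (x t - P))\<^sup>2) \<longlongrightarrow> 0) at_top"
    proof (rule tendsto_sandwich[OF _ _ tendsto_const upper])
      show "\<forall>\<^sub>F t in at_top. (norm (x t - P))\<^sup>2 \<le> ?V 0 / c * exp (- (k / C) * t)"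
        using eventually_ge_at_top[of 0] by eventually_elim (rule bound)
    qed simp
    from tendsto_real_sqrt[OF this] have "((\<lambda>t. norm (x t - P)) \<longlongrightarrow> 0) at_top"
      by simp
    then show ?thesis by (simp only: tendsto_norm_zero_iff LIM_zero_iff)
  qed
  ultimately show ?thesis
    unfolding asymptotically_stable_def using radius[OF r(1)] by blast
qed

text \<open>
  Chetaev's argument. If $P$ were stable, a solution starting near $P$ on a ray where the form is
  positive would exist for all times and stay in a small ball. There the rate of the form is at
  least a positive multiple of the form, which thus grows exponentially, although it is bounded on
  the ball.
\<close>
theorem unstable_if_linearization_increases:
  assumes eq: "equilibrium_point f X P" and int: "P \<in> interior X"
    and der: "strict_derivative_at f A P"
    and pos: "B w w > 0"
    and incr: "\<And>v. v \<noteq> 0 \<Longrightarrow> B v (A v) > 0"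
  shows "unstable f X P"
  unfolding unstable_def
proof (intro conjI eq notI)
  assume stable: "lyapunov_stable f X P"
  have A: "bounded_linear A" using der by (simp add: strict_derivative_at_def)
  obtain k where k: "k > 0" "\<And>v. k * (norm v)\<^sup>2 \<le> B v (A v)"
    using definite_lower_bound[OF A incr] by blast
  have fP: "f P = 0" using eq by (simp add: equilibrium_point_def)
  obtain C where C: "C > 0" "\<And>u v. \<bar>B u v\<bar> \<le> C * norm u * norm v" using upper_bound by blast
  have BC: "B v v \<le> C * (norm v)\<^sup>2" for v
    using C(2)[of v v] by (simp add: power2_eq_square mult.assoc)
  obtain r where r: "r > 0"
    "\<And>y. y \<in> cball P r \<Longrightarrow> \<bar>B (y - P) (f y) - B (y - P) (A (y - P))\<bar> \<le> k/2 * (norm (y - P))\<^sup>2"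
    using remainder_bound[OF der fP, of "k/2"] k(1) by auto
  obtain r' where r': "r' > 0" "cball P r' \<subseteq> X"
    using int mem_interior_cball by blast
  have "\<exists>\<delta>>0. \<forall>x0\<in>X. dist x0 P < \<delta> \<longrightarrow>
        (\<exists>x. solution_on f X {0..} x \<and> x 0 = x0) \<and>
        (\<forall>T>0. \<forall>x. solution_on f X {0..<T} x \<and> x 0 = x0 \<longrightarrow>
           (\<forall>t\<in>{0..<T}. dist (x t) P < r))"
    using stable \<open>r > 0\<close> by (simp add: lyapunov_stable_def)
  then obtain \<delta> where \<delta>: "\<delta> > 0" and st:
    "\<forall>x0\<in>X. dist x0 P < \<delta> \<longrightarrow>
        (\<exists>x. solution_on f X {0..} x \<and> x 0 = x0) \<and>
        (\<forall>T>0. \<forall>x. solution_on f X {0..<T} x \<and> x 0 = x0 \<longrightarrow>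
           (\<forall>t\<in>{0..<T}. dist (x t) P < r))"
    by (elim exE conjE)
  have w: "w \<noteq> 0" using pos by (auto simp: zero_left)
  define a where "a = min r' (\<delta>/2) / norm w"
  have a: "a > 0" "norm (a *\<^sub>R w) \<le> r'" "norm (a *\<^sub>R w) < \<delta>"
    using w r'(1) \<delta> by (auto simp: a_def)
  define x0 where "x0 = P + a *\<^sub>R w"
  have x0: "x0 \<in> X" "dist x0 P < \<delta>"
    using a r'(2) by (auto simp: x0_def dist_norm)
  with st have start: "\<exists>x. solution_on f X {0..} x \<and> x 0 = x0"
    and near: "\<forall>T>0. \<forall>x. solution_on f X {0..<T} x \<and> x 0 = x0 \<longrightarrow>
           (\<forall>t\<in>{0..<T}. dist (x t) P < r)" by simp_all
  from start obtain x where x: "solution_on f X {0..} x" "x 0 = x0" by (elim exE conjE)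
  have inball: "x t \<in> cball P r" if "t \<ge> 0" for t
  proof -
    have "solution_on f X {0..<t+1} x" by (rule solution_on_subset[OF x(1)]) auto
    moreover have "0 < t + 1" "t \<in> {0..<t+1}" using that by auto
    ultimately have "dist (x t) P < r" using near[rule_format, of "t + 1" x t] x(2) by simp
    then show ?thesis by (simp add: dist_commute)
  qed
  let ?V = "\<lambda>t. B (x t - P) (x t - P)"
  have V0: "?V 0 > 0"
    using pos a(1) by (simp add: x(2) x0_def scaleR_left scaleR_right)
  have growth: "exp (k / C * t) * ?V 0 \<le> ?V t" if "t \<ge> 0" for t
  proof -
    have sol: "solution_on f X {0..t} x" by (rule solution_on_subset[OF x(1)]) auto
    have "- ?V t \<le> exp (k / C * t) * - ?V 0"
    proof (rule exponential_comparison[OF that])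
      show "continuous_on {0..t} (\<lambda>t. - ?V t)"
        using along_solution(1)[OF sol] by (intro continuous_intros)
      fix \<tau> assume \<tau>: "0 < \<tau>" "\<tau> < t"
      show "((\<lambda>t. - ?V t) has_real_derivative - (2 * B (x \<tau> - P) (f (x \<tau>)))) (at \<tau>)"
        by (intro DERIV_minus along_solution(2)[OF sol \<tau>])
      have "k / C * ?V \<tau> \<le> k / C * (C * (norm (x \<tau> - P))\<^sup>2)"
        using BC[of "x \<tau> - P"] k(1) C(1) by (intro mult_left_mono) auto
      also have "\<dots> = k * (norm (x \<tau> - P))\<^sup>2" using C(1) by simp
      also have "\<dots> \<le> 2 * B (x \<tau> - P) (f (x \<tau>))"
      proof -
        have "x \<tau> \<in> cball P r" using inball \<tau>(1) by simp
        from r(2)[OF this] k(2)[of "x \<tau> - P"] show ?thesis by linarith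
      qed
      finally show "- (2 * B (x \<tau> - P) (f (x \<tau>))) \<le> k / C * - ?V \<tau>" by simp
    qed
    then show ?thesis by simp
  qed
  have upper: "?V t \<le> C * r\<^sup>2" if "t \<ge> 0" for t
  proof -
    have "(norm (x t - P))\<^sup>2 \<le> r\<^sup>2"
      using inball[OF that] by (intro power_mono) (auto simp: dist_norm norm_minus_commute)
    then have "C * (norm (x t - P))\<^sup>2 \<le> C * r\<^sup>2" using C(1) by (intro mult_left_mono) auto
    with BC[of "x t - P"] show ?thesis by linarith
  qed
  \<comment> \<open>Since \<open>exp u \<ge> 1 + u\<close>, at this time the lower bound on the form exceeds the upper one.\<close>
  define t where "t = C / k * (C * r\<^sup>2 / ?V 0 + 1)"
  have t: "t \<ge> 0" using C(1) k(1) V0 by (simp add: t_def)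
  have "C * r\<^sup>2 / ?V 0 < exp (k / C * t)"
    using exp_ge_add_one_self[of "k / C * t"] C(1) k(1) by (simp add: t_def)
  then have "C * r\<^sup>2 < exp (k / C * t) * ?V 0" using V0 by (simp add: field_simps)
  with growth[OF t] upper[OF t] show False by linarith
qed

end

section \<open>Quadratic forms for a third-order linear equation\<close>

text \<open>
  The first-order system of $p''' + b p'' + a p' + e p = 0$ in the variables $p$, $q = p'$, $r = p''$.
\<close>
definition companion :: "real \<Rightarrow> real \<Rightarrow> real \<Rightarrow> real \<times> real \<times> real \<Rightarrow> real \<times> real \<times> real" where
  "companion a b e = (\<lambda>(p, q, r). (q, r, - e * p - a * q - b * r))"

text \<open>
  The polarization of $(r + bq)^2 + 2epq + aq^2 + bep^2$. It comes from multiplying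
  $p''' + b p'' + a p' + e p = 0$ by $r + bq = p'' + b p'$: every product except one multiple of
  $q^2$ is the derivative of a quadratic expression in $p, q, r$.
\<close>
definition energy_form ::
  "real \<Rightarrow> real \<Rightarrow> real \<Rightarrow> real \<times> real \<times> real \<Rightarrow> real \<times> real \<times> real \<Rightarrow> real" where
  "energy_form a b e = (\<lambda>(p, q, r) (p', q', r').
     (r + b * q) * (r' + b * q') + e * (p * q' + q * p') + a * q * q' + b * e * p * p')"

text \<open>
  The polarization of $2epr - 2b^2qr$. On the plane $q = 0$, where the energy is stationary, its
  rate of change is $-2(e^2p^2 + ebpr + b^2r^2)$; the coefficients $e$ and $b^2$ are chosen so that
  this is negative definite in $(p, r)$.
\<close>
definition cross_form ::
  "real \<Rightarrow> real \<Rightarrow> real \<times> real \<times> real \<Rightarrow> real \<times> real \<times> real \<Rightarrow> real" where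
  "cross_form b e = (\<lambda>(p, q, r) (p', q', r'). e * (p * r' + r * p') - b\<^sup>2 * (q * r' + r * q'))"

lemma energy_form_companion:
  "energy_form a b e (p, q, r) (companion a b e (p, q, r)) = - (a * b - e) * q\<^sup>2"
  unfolding energy_form_def companion_def by (simp add: algebra_simps power2_eq_square)

lemma cross_form_companion_negative:
  assumes "b > 0" "e > 0" "(p, 0, r) \<noteq> 0"
  shows "cross_form b e (p, 0, r) (companion a b e (p, 0, r)) < 0"
proof -
  have "cross_form b e (p, 0, r) (companion a b e (p, 0, r))
      = - ((e * p + b * r / 2)\<^sup>2 + 3 / 4 * (b * r)\<^sup>2)"
    unfolding cross_form_def companion_def by (simp add: algebra_simps power2_eq_square)
  moreover have "(e * p + b * r / 2)\<^sup>2 + 3 / 4 * (b * r)\<^sup>2 > 0"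
  proof (cases "r = 0")
    case True
    then show ?thesis using assms by (simp add: zero_prod_def)
  next
    case False
    then have "(b * r)\<^sup>2 > 0" using assms by simp
    then show ?thesis by (simp add: add_nonneg_pos)
  qed
  ultimately show ?thesis by simp
qed

lemma energy_form_positive:
  assumes "a > 0" "b > 0" "e > 0" "e < a * b" "v \<noteq> 0"
  shows "energy_form a b e v v > 0"
proof -
  obtain p q r where v: "v = (p, q, r)" by (metis prod_cases3)
  have "b - e / a > 0" using assms by (simp add: field_simps)
  \<comment> \<open>Completing the square in \<open>q\<close> leaves \<open>p\<^sup>2\<close> with a coefficient that is positive exactly when \<open>e < a * b\<close>.\<close>
  have "energy_form a b e v v = (r + b * q)\<^sup>2 + a * (q + e / a * p)\<^sup>2 + e * (b - e / a) * p\<^sup>2"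
    using assms(1) by (simp add: v energy_form_def field_simps power2_eq_square)
  moreover have "(r + b * q)\<^sup>2 + a * (q + e / a * p)\<^sup>2 + e * (b - e / a) * p\<^sup>2 > 0"
  proof (cases "p = 0")
    case True
    have "(r + b * q)\<^sup>2 + a * q\<^sup>2 > 0"
    proof (cases "q = 0")
      case False
      then show ?thesis using assms(1) by (simp add: add_nonneg_pos)
    qed (use True assms(5) v in \<open>auto simp: zero_prod_def\<close>)
    then show ?thesis using True by simp
  next
    case False
    then have "e * (b - e / a) * p\<^sup>2 > 0" using \<open>b - e / a > 0\<close> assms(3) by simp
    then show ?thesis using assms(1) by (simp add: add_nonneg_pos)
  qed
  ultimately show ?thesis by simp
qed

lemma symmetric_form_combination:
  "symmetric_form (\<lambda>u v. K * energy_form a b e u v + \<sigma> * cross_form b e u v)"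
proof -
  have "bilinear (\<lambda>u v. K * energy_form a b e u v + \<sigma> * cross_form b e u v)"
    unfolding bilinear_def
    by (auto intro!: linearI simp: energy_form_def cross_form_def algebra_simps)
  then have "bounded_bilinear (\<lambda>u v. K * energy_form a b e u v + \<sigma> * cross_form b e u v)"
    by (simp add: bilinear_conv_bounded_bilinear)
  moreover have "K * energy_form a b e u v + \<sigma> * cross_form b e u v
      = K * energy_form a b e v u + \<sigma> * cross_form b e v u" for u v
    by (cases u; cases v) (simp add: energy_form_def cross_form_def algebra_simps)
  ultimately show ?thesis by (simp add: symmetric_form_def symmetric_form_axioms_def)
qed

lemma continuous_homogeneous_forms:
  "continuous_on UNIV (\<lambda>v. energy_form a b e v v)"
  "continuous_on UNIV (\<lambda>v. cross_form b e v v)"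
  "continuous_on UNIV (\<lambda>v. cross_form b e v (companion a b e v))"
  "energy_form a b e (t *\<^sub>R v) (t *\<^sub>R v) = t\<^sup>2 * energy_form a b e v v"
  "cross_form b e (t *\<^sub>R v) (t *\<^sub>R v) = t\<^sup>2 * cross_form b e v v"
  "cross_form b e (t *\<^sub>R v) (companion a b e (t *\<^sub>R v)) = t\<^sup>2 * cross_form b e v (companion a b e v)"
  by (auto intro!: continuous_intros
      simp: energy_form_def cross_form_def companion_def case_prod_unfold power2_eq_square algebra_simps)

text \<open>
  Finsler's lemma for the rates: the energy contributes a multiple of $q^2$ of known sign, the cross
  form takes care of the plane $q = 0$. Here $\Delta$ stands for $\pm(ab - e)$.
\<close>
lemma rate_definite_for_large_weight:
  assumes "b > 0" "e > 0" "\<Delta> > 0"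
  obtains K\<^sub>0 where
    "\<And>K v. \<lbrakk>K \<ge> K\<^sub>0; v \<noteq> 0\<rbrakk> \<Longrightarrow> K * (\<Delta> * (fst (snd v))\<^sup>2) - cross_form b e v (companion a b e v) > 0"
proof (rule finsler[of "\<lambda>v. \<Delta> * (fst (snd v))\<^sup>2" "\<lambda>v. - cross_form b e v (companion a b e v)"])
  fix v :: "real \<times> real \<times> real" assume v: "v \<noteq> 0" "\<Delta> * (fst (snd v))\<^sup>2 = 0"
  then obtain p r where "v = (p, 0, r)" using assms(3) by (cases v) auto
  then show "- cross_form b e v (companion a b e v) > 0"
    using cross_form_companion_negative[of b e p r a] v(1) assms by simp
qed (use assms that in \<open>auto intro!: continuous_intros continuous_homogeneous_forms
      simp: continuous_homogeneous_forms power_mult_distrib\<close>)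

text \<open>
  The form is $KE + N$, with $K$ large enough both for the rate and for positivity; the latter is
  possible because $E$ itself is positive definite when $e < ab$.
\<close>
theorem companion_decreasing_form:
  assumes "a > 0" "b > 0" "e > 0" "e < a * b"
  obtains B where "symmetric_form B" "\<And>v. v \<noteq> 0 \<Longrightarrow> B v v > 0"
    "\<And>v. v \<noteq> 0 \<Longrightarrow> B v (companion a b e v) < 0"
proof -
  have "a * b - e > 0" using assms by simp
  then obtain K\<^sub>1 where K1: "\<And>K v. \<lbrakk>K \<ge> K\<^sub>1; v \<noteq> 0\<rbrakk> \<Longrightarrow>
      K * ((a * b - e) * (fst (snd v))\<^sup>2) - cross_form b e v (companion a b e v) > 0"
    using rate_definite_for_large_weight[OF assms(2,3)] by blast
  obtain K\<^sub>2 where K2: "\<And>K v. \<lbrakk>K \<ge> K\<^sub>2; v \<noteq> 0\<rbrakk> \<Longrightarrow> K * energy_form a b e v v + cross_form b e v v > 0"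
  proof (rule finsler[of "\<lambda>v. energy_form a b e v v" "\<lambda>v. cross_form b e v v"])
    fix v :: "real \<times> real \<times> real"
    show "energy_form a b e v v \<ge> 0"
      using energy_form_positive[OF assms, of v] continuous_homogeneous_forms(4)[of a b e 0 0]
      by (cases "v = 0") auto
    assume "v \<noteq> 0" "energy_form a b e v v = 0"
    then show "cross_form b e v v > 0" using energy_form_positive[OF assms, of v] by simp
  qed (use that in \<open>auto intro!: continuous_homogeneous_forms\<close>)
  define K where "K = max K\<^sub>1 K\<^sub>2"
  show ?thesis
  proof (rule that[OF symmetric_form_combination[of K a b e 1]])
    fix v :: "real \<times> real \<times> real" assume v: "v \<noteq> 0"
    show "K * energy_form a b e v v + 1 * cross_form b e v v > 0"
      using K2[of K v] v by (simp add: K_def)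
    obtain p q r where v': "v = (p, q, r)" by (metis prod_cases3)
    show "K * energy_form a b e v (companion a b e v) + 1 * cross_form b e v (companion a b e v) < 0"
      using K1[of K v] v unfolding v' energy_form_companion by (simp add: K_def algebra_simps)
  qed
qed

text \<open>
  The form is $KE - N$: now $E$ increases off the plane $q = 0$, and $-N$ increases on it. At
  $(p, q, r) = (0, 0, 1)$ the form has the value $K > 0$.
\<close>
theorem companion_increasing_form:
  assumes "b > 0" "e > 0" "a * b < e"
  obtains B w where "symmetric_form B" "B w w > 0"
    "\<And>v. v \<noteq> 0 \<Longrightarrow> B v (companion a b e v) > 0"
proof -
  have "e - a * b > 0" using assms by simp
  then obtain K\<^sub>1 where K1: "\<And>K v. \<lbrakk>K \<ge> K\<^sub>1; v \<noteq> 0\<rbrakk> \<Longrightarrow>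
      K * ((e - a * b) * (fst (snd v))\<^sup>2) - cross_form b e v (companion a b e v) > 0"
    using rate_definite_for_large_weight[OF assms(1,2)] by blast
  define K where "K = max K\<^sub>1 1"
  show ?thesis
  proof (rule that[OF symmetric_form_combination[of K a b e "-1"]])
    show "K * energy_form a b e (0, 0, 1) (0, 0, 1) + -1 * cross_form b e (0, 0, 1) (0, 0, 1) > 0"
      by (simp add: energy_form_def cross_form_def K_def)
    fix v :: "real \<times> real \<times> real" assume v: "v \<noteq> 0"
    obtain p q r where v': "v = (p, q, r)" by (metis prod_cases3)
    show "K * energy_form a b e v (companion a b e v) + -1 * cross_form b e v (companion a b e v) > 0"
      using K1[of K v] v unfolding v' energy_form_companion by (simp add: K_def algebra_simps)
  qed
qed

lemma symmetric_form_pullback: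
  fixes T :: "'a::euclidean_space \<Rightarrow> 'b::euclidean_space"
  assumes "symmetric_form B" "linear T"
  shows "symmetric_form (\<lambda>u v. B (T u) (T v))"
proof -
  interpret symmetric_form B by fact
  have "bounded_bilinear (\<lambda>u v. B (T u) (T v))"
    using assms(2) by (intro comp) (simp_all add: linear_conv_bounded_linear)
  then show ?thesis by (simp add: symmetric_form_def symmetric_form_axioms_def sym)
qed

section \<open>The linearized governor\<close>

text \<open>
  The Jacobian of any field $(\varphi, \psi, \Omega) \mapsto (\psi, G(\varphi, \psi, \Omega), H(\varphi))$: its
  parameters are the three partial derivatives of $G$ and the derivative of $H$.
\<close>
definition governor_jacobian ::
  "real \<Rightarrow> real \<Rightarrow> real \<Rightarrow> real \<Rightarrow> real \<times> real \<times> real \<Rightarrow> real \<times> real \<times> real" where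
  "governor_jacobian \<alpha> \<beta> \<gamma> \<delta> = (\<lambda>(x, y, z). (y, \<alpha> * x + \<beta> * y + \<gamma> * z, \<delta> * x))"

text \<open>
  The new coordinate is $p = cz$; the other two are its first and second derivatives along the
  linear system, $cz' = -cdx$ and $-cdx' = -cdy$.
\<close>
lemma governor_jacobian_companion:
  fixes a b c d :: real
  assumes "c * d \<noteq> 0"
  obtains T where "linear T" "\<And>v. v \<noteq> 0 \<Longrightarrow> T v \<noteq> 0"
    "\<And>v. T (governor_jacobian (- a) (- b) c (- d) v) = companion a b (c * d) (T v)"
proof
  define T where "T = (\<lambda>(x, y, z). (c * z, - (c * d) * x, - (c * d) * y))"
  show "linear T" by (rule linearI) (auto simp: T_def algebra_simps)
  show "v \<noteq> 0 \<Longrightarrow> T v \<noteq> 0" for v using assms by (cases v) (auto simp: T_def zero_prod_def)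
  show "T (governor_jacobian (- a) (- b) c (- d) v) = companion a b (c * d) (T v)" for v
    by (cases v) (auto simp: T_def governor_jacobian_def companion_def algebra_simps)
qed

theorem stability_by_routh_hurwitz:
  assumes "equilibrium_point f X P" "P \<in> interior X"
    and "strict_derivative_at f (governor_jacobian (- a) (- b) c (- d)) P"
    and pos: "a > 0" "b > 0" "c > 0" "d > 0"
  shows "c * d < a * b \<Longrightarrow> asymptotically_stable f X P"
    and "a * b < c * d \<Longrightarrow> unstable f X P"
proof -
  have cd: "c * d > 0" using pos by simp
  then obtain T where T: "linear T" "\<And>v. v \<noteq> 0 \<Longrightarrow> T v \<noteq> 0"
    "\<And>v. T (governor_jacobian (- a) (- b) c (- d) v) = companion a b (c * d) (T v)"
    using governor_jacobian_companion[of c d a b] by (metis less_irrefl)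
  {
    assume "c * d < a * b"
    then obtain B where B: "symmetric_form B" "\<And>v. v \<noteq> 0 \<Longrightarrow> B v v > 0"
      "\<And>v. v \<noteq> 0 \<Longrightarrow> B v (companion a b (c * d) v) < 0"
      using companion_decreasing_form[OF pos(1,2) cd] by blast
    then show "asymptotically_stable f X P"
      using T by (intro symmetric_form.asymptotically_stable_if_linearization_decreases
          [OF symmetric_form_pullback[OF B(1) T(1)] assms(1-3)]) auto
  next
    assume "a * b < c * d"
    then obtain B w where B: "symmetric_form B" "B w w > 0"
      "\<And>v. v \<noteq> 0 \<Longrightarrow> B v (companion a b (c * d) v) > 0"
      using companion_increasing_form[OF pos(2) cd] by metis
    have "inj T" using T(1,2) by (metis linear_injective_0)
    then obtain u where "T u = w" using T(1) linear_injective_imp_surjective by (metis surjD)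
    then show "unstable f X P"
      using T B by (intro symmetric_form.unstable_if_linearization_increases
          [OF symmetric_form_pullback[OF B(1) T(1)] assms(1-3), of u]) auto
  }
qed

section \<open>Regularity of the governor field\<close>

text \<open>
  The Jacobian depends continuously on the point, so near $P$ the map $f$ minus its linearization at
  $P$ has a derivative of small operator norm; the mean value inequality between two arbitrary
  points of a ball gives the claim.
\<close>
lemma governor_jacobian_strict:
  assumes U: "open U" "P \<in> U"
    and der: "\<And>p. p \<in> U \<Longrightarrow>
      (f has_derivative governor_jacobian (\<alpha> p) (\<beta> p) (\<gamma> p) (\<delta> p)) (at p)"
    and cont: "isCont \<alpha> P" "isCont \<beta> P" "isCont \<gamma> P" "isCont \<delta> P"
  shows "strict_derivative_at f (governor_jacobian (\<alpha> P) (\<beta> P) (\<gamma> P) (\<delta> P)) P"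
  unfolding strict_derivative_at_def
proof (intro conjI allI impI)
  let ?J = "\<lambda>p. governor_jacobian (\<alpha> p) (\<beta> p) (\<gamma> p) (\<delta> p)"
  show bl: "bounded_linear (?J P)" using der[OF U(2)] by (rule has_derivative_bounded_linear)
  fix \<epsilon> :: real assume "\<epsilon> > 0"
  define d where "d = (\<lambda>p. \<bar>\<alpha> p - \<alpha> P\<bar> + \<bar>\<beta> p - \<beta> P\<bar> + \<bar>\<gamma> p - \<gamma> P\<bar> + \<bar>\<delta> p - \<delta> P\<bar>)"
  have "isCont d P" unfolding d_def by (intro cont continuous_add continuous_rabs continuous_diff continuous_const)
  then have "d \<midarrow>P\<rightarrow> 0" by (simp add: isCont_def d_def)
  then have "\<exists>r>0. \<forall>p. p \<noteq> P \<and> dist p P < r \<longrightarrow> dist (d p) 0 < \<epsilon>"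
    using \<open>\<epsilon> > 0\<close> by (simp add: LIM_def)
  then obtain r1 where r1: "r1 > 0" "\<And>p. dist p P < r1 \<Longrightarrow> p \<noteq> P \<Longrightarrow> d p < \<epsilon>"
    by (elim exE conjE) (force simp: dist_real_def)
  have "d P = 0" by (simp add: d_def)
  then have d: "d p < \<epsilon>" if "dist p P < r1" for p
    using r1(2)[OF that] \<open>\<epsilon> > 0\<close> by (cases "p = P") auto
  from U obtain r2 where r2: "r2 > 0" "cball P r2 \<subseteq> U" unfolding open_contains_cball by auto
  define r where "r = min (r1 / 2) r2"
  have r: "r > 0" "r < r1" "cball P r \<subseteq> U" using r1(1) r2 by (auto simp: r_def)
  have bound: "norm ((?J p - ?J P) v) \<le> d p * norm v" for p v
  proof -
    obtain x y z where v: "v = (x, y, z)" by (metis prod_cases3)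
    have "\<bar>x\<bar> \<le> norm v" "\<bar>y\<bar> \<le> norm v" "\<bar>z\<bar> \<le> norm v"
      using norm_fst_le[of x "(y, z)"] norm_snd_le[of "(y, z)" x] norm_fst_le[of y z] norm_snd_le[of z y]
      by (simp_all add: v)
    then have *: "\<bar>c * x\<bar> \<le> \<bar>c\<bar> * norm v" "\<bar>c * y\<bar> \<le> \<bar>c\<bar> * norm v" "\<bar>c * z\<bar> \<le> \<bar>c\<bar> * norm v" for c
      unfolding abs_mult by (simp_all add: mult_left_mono)
    let ?a = "(\<alpha> p - \<alpha> P) * x" and ?b = "(\<beta> p - \<beta> P) * y" and ?c = "(\<gamma> p - \<gamma> P) * z"
      and ?d = "(\<delta> p - \<delta> P) * x"
    have "(?J p - ?J P) v = (0, ?a + ?b + ?c, ?d)"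
      by (simp add: v governor_jacobian_def algebra_simps)
    then have "norm ((?J p - ?J P) v) \<le> \<bar>?a + ?b + ?c\<bar> + \<bar>?d\<bar>"
      using norm_Pair_le[of "0::real" "(?a + ?b + ?c, ?d)"] norm_Pair_le[of "?a + ?b + ?c" ?d] by simp
    also have "\<dots> \<le> (\<bar>?a\<bar> + \<bar>?b\<bar> + \<bar>?c\<bar>) + \<bar>?d\<bar>"
      by (intro add_right_mono order_trans[OF abs_triangle_ineq] abs_triangle_ineq)
    also have "\<dots> \<le> (\<bar>\<alpha> p - \<alpha> P\<bar> * norm v + \<bar>\<beta> p - \<beta> P\<bar> * norm v + \<bar>\<gamma> p - \<gamma> P\<bar> * norm v)
        + \<bar>\<delta> p - \<delta> P\<bar> * norm v"
      by (intro add_mono *)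
    also have "\<dots> = d p * norm v" by (simp only: d_def distrib_right)
    finally show ?thesis .
  qed
  have "norm (f x - f y - ?J P (x - y)) \<le> \<epsilon> * norm (x - y)"
    if xy: "x \<in> cball P r" "y \<in> cball P r" for x y
  proof -
    have "norm ((f x - ?J P x) - (f y - ?J P y)) \<le> \<epsilon> * norm (x - y)"
    proof (rule differentiable_bound[OF convex_cball _ _ xy])
      fix p assume p: "p \<in> cball P r"
      have "(f has_derivative ?J p) (at p within cball P r)"
        using p r(3) by (intro has_derivative_at_withinI[OF der]) auto
      then show "((\<lambda>p. f p - ?J P p) has_derivative (\<lambda>v. ?J p v - ?J P v)) (at p within cball P r)"
        by (rule has_derivative_diff[OF _ bounded_linear_imp_has_derivative[OF bl]])
      show "onorm (\<lambda>v. ?J p v - ?J P v) \<le> \<epsilon>"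
      proof (rule onorm_le)
        fix v
        have "norm (?J p v - ?J P v) \<le> d p * norm v" using bound[of p v] by simp
        also have "\<dots> \<le> \<epsilon> * norm v"
          using d[of p] p r(2) by (intro mult_right_mono) (auto simp: dist_commute)
        finally show "norm (?J p v - ?J P v) \<le> \<epsilon> * norm v" .
      qed
    qed
    moreover have "f x - f y - ?J P (x - y) = (f x - ?J P x) - (f y - ?J P y)"
      by (simp add: linear_diff[OF bounded_linear.linear[OF bl]])
    ultimately show ?thesis by (simp only:)
  qed
  then show "\<exists>r>0. \<forall>x\<in>cball P r. \<forall>y\<in>cball P r.
      norm (f x - f y - ?J P (x - y)) \<le> \<epsilon> * norm (x - y)" by (intro exI[of _ r] conjI r(1) ballI)
qed

text \<open>
  Near an interior point the derivatives within $S$ are ordinary ones, and the second member of the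
  witnessing sequence coincides with the derivative; being differentiable itself, it is continuous.
\<close>
lemma smooth_on_interior:
  assumes "smooth_on S f" "x \<in> interior S"
  shows "(f has_real_derivative deriv f x) (at x)" and "isCont (deriv f) x"
proof -
  obtain D where D0: "D 0 = f"
    and D: "\<And>k x. x \<in> S \<Longrightarrow> (D k has_real_derivative D (Suc k) x) (at x within S)"
    using assms(1) unfolding smooth_on_def by blast
  have D': "(D k has_real_derivative D (Suc k) y) (at y)" if "y \<in> interior S" for k y
    using D[of y k] that interior_subset[of S] at_within_interior[OF that] by auto
  have d: "deriv f y = D (Suc 0) y" if "y \<in> interior S" for y
    using D'[OF that, of 0] by (simp add: D0 DERIV_imp_deriv)
  show "(f has_real_derivative deriv f x) (at x)"
    using D'[OF assms(2), of 0] d[OF assms(2)] by (simp add: D0)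
  have "isCont (D (Suc 0)) x" using D'[OF assms(2)] by (rule DERIV_isCont)
  moreover have "\<forall>\<^sub>F y in nhds x. deriv f y = D (Suc 0) y"
    using eventually_nhds_in_open[OF open_interior assms(2)] by eventually_elim (rule d)
  ultimately show "isCont (deriv f) x" by (simp add: isCont_cong)
qed

lemma governor_field_has_derivative:
  assumes "(s has_real_derivative s') (at \<Omega>)" "(h has_real_derivative h') (at \<psi>)"
    "(M has_real_derivative M') (at \<phi>)"
  shows "(governor_field g l m I F s h M has_derivative
      governor_jacobian ((s \<Omega>)\<^sup>2 * ((cos \<phi>)\<^sup>2 - (sin \<phi>)\<^sup>2) - g / l * cos \<phi>) (- h' / m)
        (2 * s \<Omega> * s' * sin \<phi> * cos \<phi>) (M' / I)) (at (\<phi>, \<psi>, \<Omega>))"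
proof -
  let ?P = "(\<phi>, \<psi>, \<Omega>)"
  have [derivative_intros]:
    "((\<lambda>p. s (snd (snd p))) has_derivative (\<lambda>v. snd (snd v) * s')) (at ?P)"
    "((\<lambda>p. h (fst (snd p))) has_derivative (\<lambda>v. fst (snd v) * h')) (at ?P)"
    "((\<lambda>p. M (fst p)) has_derivative (\<lambda>v. fst v * M')) (at ?P)"
    "((\<lambda>p::real \<times> real \<times> real. sin (fst p)) has_derivative (\<lambda>v. fst v * cos \<phi>)) (at ?P)"
    "((\<lambda>p::real \<times> real \<times> real. cos (fst p)) has_derivative (\<lambda>v. fst v * - sin \<phi>)) (at ?P)"
    by (rule DERIV_compose_FDERIV; (simp add: assms DERIV_sin DERIV_cos; fail)?;
        auto intro!: derivative_eq_intros)+
  show ?thesis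
    unfolding governor_field_def case_prod_unfold
    by (rule has_derivative_eq_rhs, (rule derivative_intros)+)
      (auto simp: governor_jacobian_def fun_eq_iff algebra_simps power2_eq_square divide_simps)
qed

section \<open>Stability of the governor\<close>

theorem theorem2p2:
  fixes g l m I F \<phi>\<^sub>0 \<Omega>\<^sub>0 :: real
    and s h M :: "real \<Rightarrow> real"
  assumes "g > 0" and "l > 0" and "m > 0" and "I > 0"
    and "smooth_on {0..} s" and "\<forall>\<Omega>\<ge>0. s \<Omega> \<ge> 0" and "mono_on {0..} s" and "s 0 = 0"
    and "smooth_on UNIV h" and "mono h" and "h 0 = 0"
    and "smooth_on {0<..<pi/2} M" and "antimono_on {0<..<pi/2} M"
    and "equilibrium_point (governor_field g l m I F s h M) state_space (\<phi>\<^sub>0, 0, \<Omega>\<^sub>0)"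
    and "deriv s \<Omega>\<^sub>0 > 0" and "deriv M \<phi>\<^sub>0 < 0"
  shows "(deriv h 0 > - (2 * m / I) * (deriv s \<Omega>\<^sub>0 / s \<Omega>\<^sub>0) * deriv M \<phi>\<^sub>0 * cot \<phi>\<^sub>0 \<longrightarrow>
            asymptotically_stable (governor_field g l m I F s h M) state_space (\<phi>\<^sub>0, 0, \<Omega>\<^sub>0)) \<and>
         (0 < deriv h 0 \<and>
          deriv h 0 < - (2 * m / I) * (deriv s \<Omega>\<^sub>0 / s \<Omega>\<^sub>0) * deriv M \<phi>\<^sub>0 * cot \<phi>\<^sub>0 \<longrightarrow>
            unstable (governor_field g l m I F s h M) state_space (\<phi>\<^sub>0, 0, \<Omega>\<^sub>0))"
proof -
  let ?f = "governor_field g l m I F s h M" and ?P = "(\<phi>\<^sub>0, 0, \<Omega>\<^sub>0) :: real \<times> real \<times> real"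
  note eq = \<open>equilibrium_point ?f state_space ?P\<close>
  have range: "0 < \<phi>\<^sub>0" "\<phi>\<^sub>0 < pi/2" "\<Omega>\<^sub>0 \<ge> 0"
    using eq by (auto simp: equilibrium_point_def state_space_def)
  have trig: "sin \<phi>\<^sub>0 > 0" "cos \<phi>\<^sub>0 > 0"
    using range by (auto intro!: sin_gt_zero cos_gt_zero)
  have "(s \<Omega>\<^sub>0)\<^sup>2 * sin \<phi>\<^sub>0 * cos \<phi>\<^sub>0 - g / l * sin \<phi>\<^sub>0 = 0"
    using eq \<open>h 0 = 0\<close> by (simp add: equilibrium_point_def governor_field_def zero_prod_def)
  then have "sin \<phi>\<^sub>0 * ((s \<Omega>\<^sub>0)\<^sup>2 * cos \<phi>\<^sub>0 - g / l) = 0" by (simp add: algebra_simps)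
  then have balance: "(s \<Omega>\<^sub>0)\<^sup>2 * cos \<phi>\<^sub>0 = g / l" using trig by simp
  then have "s \<Omega>\<^sub>0 \<noteq> 0" using \<open>g > 0\<close> \<open>l > 0\<close> by (auto simp: zero_less_divide_iff)
  then have s_pos: "s \<Omega>\<^sub>0 > 0" and \<Omega>_pos: "\<Omega>\<^sub>0 > 0"
    using range(3) \<open>\<forall>\<Omega>\<ge>0. s \<Omega> \<ge> 0\<close> \<open>s 0 = 0\<close> by (auto simp: less_le)
  let ?U = "{0<..<pi/2} \<times> UNIV \<times> {0<..} :: (real \<times> real \<times> real) set"
  have U: "open ?U" "?P \<in> ?U" "?U \<subseteq> state_space"
    using range \<Omega>_pos by (auto simp: state_space_def intro!: open_Times)
  then have int: "?P \<in> interior state_space" by (rule interiorI)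
  have s_int: "\<Omega> \<in> interior {0..}" if "\<Omega> > 0" for \<Omega> :: real
    using that by (simp add: interior_real_atLeast)
  define \<alpha> :: "real \<times> real \<times> real \<Rightarrow> real" where "\<alpha> = (\<lambda>(\<phi>, \<psi>, \<Omega>). (s \<Omega>)\<^sup>2 * ((cos \<phi>)\<^sup>2 - (sin \<phi>)\<^sup>2) - g / l * cos \<phi>)"
  define \<beta> :: "real \<times> real \<times> real \<Rightarrow> real" where "\<beta> = (\<lambda>(\<phi>, \<psi>, \<Omega>). - deriv h \<psi> / m)"
  define \<gamma> :: "real \<times> real \<times> real \<Rightarrow> real" where "\<gamma> = (\<lambda>(\<phi>, \<psi>, \<Omega>). 2 * s \<Omega> * deriv s \<Omega> * sin \<phi> * cos \<phi>)"
  define \<delta> :: "real \<times> real \<times> real \<Rightarrow> real" where "\<delta> = (\<lambda>(\<phi>, \<psi>, \<Omega>). deriv M \<phi> / I)"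
  have "strict_derivative_at ?f (governor_jacobian (\<alpha> ?P) (\<beta> ?P) (\<gamma> ?P) (\<delta> ?P)) ?P"
  proof (rule governor_jacobian_strict[OF U(1,2)])
    fix p assume "p \<in> ?U"
    then obtain \<phi> \<psi> \<Omega> where p: "p = (\<phi>, \<psi>, \<Omega>)" "\<phi> \<in> {0<..<pi/2}" "\<Omega> > 0" by auto
    show "(?f has_derivative governor_jacobian (\<alpha> p) (\<beta> p) (\<gamma> p) (\<delta> p)) (at p)"
      unfolding p(1) \<alpha>_def \<beta>_def \<gamma>_def \<delta>_def prod.case
      using p(2,3) by (intro governor_field_has_derivative smooth_on_interior(1)
          [OF \<open>smooth_on {0..} s\<close> s_int] smooth_on_interior(1)[OF \<open>smooth_on UNIV h\<close>]
          smooth_on_interior(1)[OF \<open>smooth_on {0<..<pi/2} M\<close>]) auto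
  next
    have "isCont s \<Omega>\<^sub>0" "isCont (deriv s) \<Omega>\<^sub>0" "isCont (deriv h) 0" "isCont (deriv M) \<phi>\<^sub>0"
      using smooth_on_interior[OF \<open>smooth_on {0..} s\<close> s_int[OF \<Omega>_pos]]
        smooth_on_interior(2)[OF \<open>smooth_on UNIV h\<close>, of 0]
        smooth_on_interior(2)[OF \<open>smooth_on {0<..<pi/2} M\<close>, of \<phi>\<^sub>0] range
      by (auto intro: DERIV_isCont)
    then have "isCont (\<lambda>p. s (snd (snd p))) ?P" "isCont (\<lambda>p. deriv s (snd (snd p))) ?P"
      "isCont (\<lambda>p. deriv h (fst (snd p))) ?P" "isCont (\<lambda>p. deriv M (fst p)) ?P"
      using isCont_o2[of ?P "\<lambda>p. snd (snd p)" s] isCont_o2[of ?P "\<lambda>p. snd (snd p)" "deriv s"]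
        isCont_o2[of ?P "\<lambda>p. fst (snd p)" "deriv h"] isCont_o2[of ?P fst "deriv M"]
      by (simp_all add: continuous_fst continuous_snd)
    then show "isCont \<alpha> ?P" "isCont \<beta> ?P" "isCont \<gamma> ?P" "isCont \<delta> ?P"
      unfolding \<alpha>_def \<beta>_def \<gamma>_def \<delta>_def case_prod_unfold
      using \<open>l > 0\<close> \<open>m > 0\<close> \<open>I > 0\<close> by (auto intro!: continuous_intros)
  qed
  moreover define a where "a = (s \<Omega>\<^sub>0)\<^sup>2 * (sin \<phi>\<^sub>0)\<^sup>2"
  moreover define b where "b = deriv h 0 / m"
  moreover define c where "c = 2 * s \<Omega>\<^sub>0 * deriv s \<Omega>\<^sub>0 * sin \<phi>\<^sub>0 * cos \<phi>\<^sub>0"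
  moreover define d where "d = - deriv M \<phi>\<^sub>0 / I"
  \<comment> \<open>Replacing \<open>g / l\<close> by \<open>(s \<Omega>\<^sub>0)\<^sup>2 * cos \<phi>\<^sub>0\<close> cancels the cosines.\<close>
  moreover have "\<alpha> ?P = - a"
    using balance[symmetric] by (simp add: \<alpha>_def a_def algebra_simps power2_eq_square)
  ultimately have der: "strict_derivative_at ?f (governor_jacobian (- a) (- b) c (- d)) ?P"
    by (simp add: \<beta>_def \<gamma>_def \<delta>_def)
  define threshold where
    "threshold = - (2 * m / I) * (deriv s \<Omega>\<^sub>0 / s \<Omega>\<^sub>0) * deriv M \<phi>\<^sub>0 * cot \<phi>\<^sub>0"
  have pos: "a > 0" "c > 0" "d > 0"
    using trig s_pos \<open>deriv s \<Omega>\<^sub>0 > 0\<close> \<open>deriv M \<phi>\<^sub>0 < 0\<close> \<open>I > 0\<close>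
    by (auto simp: a_def c_def d_def divide_neg_pos)
  \<comment> \<open>After division by \<open>a / m\<close> the comparison of \<open>c * d\<close> with \<open>a * b\<close> is that of the threshold with \<open>deriv h 0\<close>.\<close>
  have cd: "c * d = a * (threshold / m)"
    using trig s_pos \<open>I > 0\<close> \<open>m > 0\<close>
    by (simp add: a_def c_def d_def threshold_def cot_def field_simps power2_eq_square)
  have ab: "a * b = a * (deriv h 0 / m)" by (simp add: b_def)
  have "threshold / m > 0" using cd pos by (metis mult_pos_pos zero_less_mult_pos)
  then have threshold: "threshold > 0" using \<open>m > 0\<close> by (simp add: zero_less_divide_iff)
  have "asymptotically_stable ?f state_space ?P" if "deriv h 0 > threshold"
  proof -
    have "b > 0" using that threshold \<open>m > 0\<close> by (simp add: b_def)
    moreover have "c * d < a * b"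
      unfolding cd ab using that pos(1) \<open>m > 0\<close> by (simp add: divide_strict_right_mono)
    ultimately show ?thesis using stability_by_routh_hurwitz(1)[OF eq int der] pos by blast
  qed
  moreover have "unstable ?f state_space ?P" if "0 < deriv h 0" "deriv h 0 < threshold"
  proof -
    have "b > 0" using that \<open>m > 0\<close> by (simp add: b_def)
    moreover have "a * b < c * d"
      unfolding cd ab using that pos(1) \<open>m > 0\<close> by (simp add: divide_strict_right_mono)
    ultimately show ?thesis using stability_by_routh_hurwitz(2)[OF eq int der] pos by blast
  qed
  ultimately show ?thesis unfolding threshold_def by blast
qed

end
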